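(* $\mathfrak{b}_{\mathrm{Fin}}(\overline{\Omega})=\mathrm{add}(\mathcal{N})$ and $\mathfrak{d}_{\mathrm{Fin}}(\overline{\Omega})=\mathrm{cof}(\mathcal{N})$.
   Context: ${}^\omega2$ has Lebesgue measure $\mu$; $\Omega$ is the set of its clopen subsets; for $\bar c\in{}^\omega\Omega$, $N(\bar c)=\{x:x\in c_n\text{ for infinitely many }n\}$ and $\overline{\Omega}=\{\bar c\in{}^\omega\Omega:\mu(N(\bar c))=0\}$. $\mathrm{Fin}$ is the ideal of finite subsets of $\omega$. For $\bar c,\bar d\in\overline{\Omega}$, $\bar c\subseteq^{\mathrm{Fin}}\bar d$ iff $c_n\subseteq d_n$ for all but finitely many $n$. $\mathfrak{b}_{\mathrm{Fin}}(\overline{\Omega})$ is the least size of a subset of $\overline{\Omega}$ with no $\subseteq^{\mathrm{Fin}}$-upper bound in $\overline{\Omega}$; $\mathfrak{d}_{\mathrm{Fin}}(\overline{\Omega})$ is the least size of $D\subseteq\overline{\Omega}$ such that every $\bar c\in\overline{\Omega}$ is $\subseteq^{\mathrm{Fin}}$-below some member of $D$. $\mathcal{N}$ is the ideal of Lebesgue null subsets of ${}^\omega2$. *)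

theory Defs
  imports "HOL-Probability.Probability" "HOL-Library.Infinite_Set"
begin

unbundle cardinal_syntax

text \<open>
  The cardinal \<open>least_size P\<close> is represented, as usual in HOL, by a cardinal well-order;
  it is meaningful only if some set satisfies \<open>P\<close> (see \<open>least_size_attained\<close> below).
  Cardinals living on different types are compared by \<open>=o\<close>.
\<close>

definition least_size :: "('a set \<Rightarrow> bool) \<Rightarrow> 'a rel" where
  "least_size P = |SOME A. P A \<and> (\<forall>B. P B \<longrightarrow> |A| \<le>o |B| )|"

lemma least_size_attained:
  assumes "P A0"
  shows "\<exists>A. P A \<and> least_size P = |A| \<and> (\<forall>B. P B \<longrightarrow> |A| \<le>o |B| )"
proof -
  let ?R = "card_of ` {A. P A}"
  have "?R \<noteq> {}" "\<forall>r\<in>?R. Card_order r"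
    using assms card_of_Card_order by auto
  then have "\<exists>r\<in>?R. \<forall>r'\<in>?R. r \<le>o r'"
    by (rule exists_minim_Card_order)
  then have "\<exists>A. P A \<and> (\<forall>B. P B \<longrightarrow> |A| \<le>o |B| )"
    by auto
  from someI_ex[OF this] show ?thesis
    unfolding least_size_def by blast
qed

type_synonym cantor = "nat \<Rightarrow> bool"

text \<open>
  The completed fair-coin measure on the Cantor space, so that its null sets are exactly the
  subsets of Borel null sets.
\<close>

definition cantor_measure :: "cantor measure" where
  "cantor_measure = completion (\<Pi>\<^sub>M n\<in>UNIV. measure_pmf (bernoulli_pmf (1/2)))"

definition null_ideal :: "cantor set set" where
  "null_ideal = null_sets cantor_measure"

definition Omega :: "cantor set set" where
  "Omega = {c. open c \<and> closed c}"

definition limsup_set :: "(nat \<Rightarrow> cantor set) \<Rightarrow> cantor set" where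
  "limsup_set c = {x. \<exists>\<^sub>\<infinity>n. x \<in> c n}"

text \<open>
  Membership in \<open>null_sets\<close> means measurable of measure zero; mere vanishing of \<open>emeasure\<close> would
  also hold for non-measurable sets.
\<close>

definition Omega_bar :: "(nat \<Rightarrow> cantor set) set" where
  "Omega_bar = {c. (\<forall>n. c n \<in> Omega) \<and> limsup_set c \<in> null_sets cantor_measure}"

definition subseteq_Fin :: "(nat \<Rightarrow> cantor set) \<Rightarrow> (nat \<Rightarrow> cantor set) \<Rightarrow> bool"
    (infix "\<subseteq>\<^sub>F\<^sub>i\<^sub>n" 50) where
  "c \<subseteq>\<^sub>F\<^sub>i\<^sub>n d \<longleftrightarrow> (\<forall>\<^sub>\<infinity>n. c n \<subseteq> d n)"

definition unbounded_Fin :: "(nat \<Rightarrow> cantor set) set \<Rightarrow> bool" where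
  "unbounded_Fin B \<longleftrightarrow> B \<subseteq> Omega_bar \<and> \<not> (\<exists>d\<in>Omega_bar. \<forall>c\<in>B. c \<subseteq>\<^sub>F\<^sub>i\<^sub>n d)"

definition dominating_Fin :: "(nat \<Rightarrow> cantor set) set \<Rightarrow> bool" where
  "dominating_Fin D \<longleftrightarrow> D \<subseteq> Omega_bar \<and> (\<forall>c\<in>Omega_bar. \<exists>d\<in>D. c \<subseteq>\<^sub>F\<^sub>i\<^sub>n d)"

definition b_Fin :: "(nat \<Rightarrow> cantor set) rel" where
  "b_Fin = least_size unbounded_Fin"

definition d_Fin :: "(nat \<Rightarrow> cantor set) rel" where
  "d_Fin = least_size dominating_Fin"

definition add_null :: "cantor set rel" where
  "add_null = least_size (\<lambda>F. F \<subseteq> null_ideal \<and> \<Union>F \<notin> null_ideal)"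

definition cof_null :: "cantor set rel" where
  "cof_null = least_size (\<lambda>F. F \<subseteq> null_ideal \<and> (\<forall>A\<in>null_ideal. \<exists>B\<in>F. A \<subseteq> B))"

text \<open>All four cardinals are minima over nonempty classes of sets.\<close>

lemma UNIV_notin_null: "(UNIV :: cantor set) \<notin> null_sets cantor_measure"
proof -
  let ?M = "\<Pi>\<^sub>M n\<in>(UNIV::nat set). measure_pmf (bernoulli_pmf (1/2))"
  interpret P: prob_space ?M
    by (intro prob_space_PiM prob_space_measure_pmf)
  have sp: "space ?M = UNIV"
    by (simp add: space_PiM PiE_def)
  have "UNIV \<in> sets ?M"
    using sets.top[of ?M] unfolding sp .
  then have "emeasure cantor_measure UNIV = emeasure ?M UNIV"
    unfolding cantor_measure_def by simp
  also have "\<dots> = 1"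
    using P.emeasure_space_1 unfolding sp .
  finally show ?thesis by auto
qed

lemma singleton_null: "{x :: cantor} \<in> null_sets cantor_measure"
proof -
  let ?M = "\<Pi>\<^sub>M n\<in>(UNIV::nat set). measure_pmf (bernoulli_pmf (1/2))"
  interpret product_prob_space "\<lambda>_::nat. measure_pmf (bernoulli_pmf (1/2))" UNIV
    by unfold_locales
  have eq: "{x} = (\<Pi>\<^sub>E n\<in>UNIV. {x n})"
    by (auto simp: PiE_def Pi_def)
  have sets: "{x} \<in> sets ?M"
    unfolding eq by (intro sets_PiM_I_countable) auto
  have le: "emeasure ?M {x} \<le> ennreal ((1/2) ^ n)" for n
  proof -
    have "emeasure ?M {x} \<le> emeasure ?M {y \<in> space ?M. \<forall>i\<in>{..<n}. y i \<in> {x i}}"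
    proof (rule emeasure_mono)
      show "{y \<in> space ?M. \<forall>i\<in>{..<n}. y i \<in> {x i}} \<in> sets ?M"
        by (intro sets.sets_Collect_finite_All sets_Collect_single') auto
    qed (auto simp: space_PiM PiE_def)
    also have "\<dots> = (\<Prod>i<n. emeasure (measure_pmf (bernoulli_pmf (1/2))) {x i})"
      by (subst emeasure_PiM_Collect) auto
    also have "\<dots> = (\<Prod>i<n. ennreal (1/2))"
    proof (intro prod.cong refl)
      fix i
      show "emeasure (measure_pmf (bernoulli_pmf (1/2))) {x i} = ennreal (1/2)"
        by (cases "x i") (simp_all add: emeasure_pmf_single)
    qed
    also have "\<dots> = ennreal ((1/2) ^ n)"
      by (simp only: prod_constant card_lessThan, simp add: ennreal_power del: ennreal_half)
    finally show ?thesis .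
  qed
  have "(\<lambda>n. ennreal ((1/2) ^ n)) \<longlonglongrightarrow> ennreal 0"
    by (intro tendsto_ennrealI LIMSEQ_power_zero) auto
  then have "emeasure ?M {x} \<le> 0"
    using le by (intro LIMSEQ_le_const) auto
  then have "{x} \<in> null_sets ?M"
    using sets by auto
  then show ?thesis
    unfolding cantor_measure_def by (rule null_sets_completionI)
qed

lemma ex_add_null: "\<exists>F. F \<subseteq> null_ideal \<and> \<Union>F \<notin> null_ideal"
proof (intro exI conjI)
  show "range (\<lambda>x. {x}) \<subseteq> null_ideal"
    using singleton_null by (auto simp: null_ideal_def)
  have "\<Union>(range (\<lambda>x::cantor. {x})) = UNIV" by auto
  then show "\<Union>(range (\<lambda>x::cantor. {x})) \<notin> null_ideal"
    using UNIV_notin_null by (simp add: null_ideal_def)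
qed

lemma ex_cof_null: "\<exists>F. F \<subseteq> null_ideal \<and> (\<forall>A\<in>null_ideal. \<exists>B\<in>F. A \<subseteq> B)"
  by blast

lemma ex_dominating_Fin: "\<exists>D. dominating_Fin D"
  unfolding dominating_Fin_def subseteq_Fin_def by (rule exI[of _ Omega_bar]) (blast intro: MOST_I)

lemma ex_unbounded_Fin: "\<exists>B. unbounded_Fin B"
proof
  define cyl :: "cantor \<Rightarrow> nat \<Rightarrow> cantor set" where "cyl x n = {y. \<forall>i<n. y i = x i}" for x n
  have clopen: "cyl x n \<in> Omega" for x n
  proof -
    have eq: "cyl x n = (\<Inter>i\<in>{..<n}. (\<lambda>y. y i) -` {x i})"
      by (auto simp: cyl_def)
    have c: "continuous_on UNIV (\<lambda>y::cantor. y i)" for i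
      by simp
    have op: "open ((\<lambda>y::cantor. y i) -` {x i})" for i
      by (intro open_vimage c Topological_Spaces.open_discrete)
    have "closed ((\<lambda>y::cantor. y i) -` {x i})" for i
      by (intro closed_vimage c closed_singleton)
    with op show ?thesis
      unfolding Omega_def eq by (auto intro!: open_INT closed_INT)
  qed
  have lim: "limsup_set (cyl x) = {x}" for x
  proof -
    have "y = x" if "\<exists>\<^sub>\<infinity>n. y \<in> cyl x n" for y
    proof
      fix i
      from that obtain n where "n > i" "y \<in> cyl x n"
        by (auto simp: INFM_nat)
      then show "y i = x i" by (auto simp: cyl_def)
    qed
    then show ?thesis
      by (auto simp: limsup_set_def cyl_def)
  qed
  show "unbounded_Fin (range cyl)"
    unfolding unbounded_Fin_def
  proof (intro conjI notI)
    show "range cyl \<subseteq> Omega_bar"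
      using clopen lim singleton_null by (auto simp: Omega_bar_def)
    assume "\<exists>d\<in>Omega_bar. \<forall>c\<in>range cyl. c \<subseteq>\<^sub>F\<^sub>i\<^sub>n d"
    then obtain d where d: "d \<in> Omega_bar" "\<And>x. cyl x \<subseteq>\<^sub>F\<^sub>i\<^sub>n d" by auto
    have "x \<in> limsup_set d" for x
    proof -
      have "\<forall>\<^sub>\<infinity>n. x \<in> d n"
        using d(2)[of x] unfolding subseteq_Fin_def
        by (rule MOST_mono) (auto simp: cyl_def)
      then show ?thesis
        unfolding limsup_set_def
        by (simp add: cofinite_eq_sequentially eventually_frequently)
    qed
    then have "limsup_set d = UNIV" by auto
    with d(1) UNIV_notin_null show False by (simp add: Omega_bar_def)
  qed
qed

end

theory Submission
  imports Defs
begin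

text \<open>
  Both equalities come from Tukey connections between the null ideal and
  \<open>Omega_bar\<close> ordered by \<open>\<subseteq>\<^sub>F\<^sub>i\<^sub>n\<close>.

  Every null set is covered by the limsup of some sequence in \<open>Omega_bar\<close>, and
  \<open>c \<subseteq>\<^sub>F\<^sub>i\<^sub>n d\<close> implies that the limsup of \<open>c\<close> lies in that of \<open>d\<close>.

  Conversely, Bartoszynski's argument codes a function \<open>f\<close> by the null set
  \<open>limsup (blk n (f n))\<close>, where for fixed \<open>n\<close> the sets \<open>blk n i\<close> are independent of measure
  \<open>2\<^sup>-\<^sup>n\<close>. If a null set \<open>A\<close> contains it, take a closed set \<open>K\<close> disjoint from \<open>A\<close> all of
  whose nonempty relatively open subsets have positive measure. By the Baire category theorem some
  nonempty portion of \<open>K\<close> misses \<open>blk n (f n)\<close> for almost all \<open>n\<close>; by independence, a portion of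
  positive measure misses only few of the \<open>blk n i\<close>, and \<open>K\<close> has only countably many portions. So
  \<open>A\<close> determines a slalom \<open>S\<close> of prescribed width that captures all such \<open>f\<close>.

  A sequence \<open>c\<close> in \<open>Omega_bar\<close> is cut into consecutive finite pieces so that the union of the
  \<open>k\<close>-th piece has measure at most \<open>\<epsilon> k\<close>, and \<open>f k\<close> is the \<open>k\<close>-th piece together with its
  position. If the \<open>\<epsilon> k\<close> decrease fast enough compared with the width of \<open>S\<close>, the union of
  all small pieces listed in \<open>S\<close> is an upper bound in \<open>Omega_bar\<close>.
\<close>

section \<open>Topology and measurability in the Cantor space\<close>

abbreviation coin :: "cantor measure" where
  "coin \<equiv> \<Pi>\<^sub>M n\<in>UNIV. measure_pmf (bernoulli_pmf (1/2))"

interpretation coin: product_prob_space "\<lambda>_::nat. measure_pmf (bernoulli_pmf (1/2))" UNIV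
  by unfold_locales

lemma space_coin [simp]: "space coin = UNIV"
  by (simp add: space_PiM PiE_def)

lemma null_ideal_iff: "A \<in> null_ideal \<longleftrightarrow> (\<exists>B\<in>null_sets coin. A \<subseteq> B)"
  unfolding null_ideal_def cantor_measure_def by (rule null_sets_completion_iff2)

lemma null_ideal_subset: "A \<in> null_ideal \<Longrightarrow> B \<subseteq> A \<Longrightarrow> B \<in> null_ideal"
  by (auto simp: null_ideal_iff)

definition cyl :: "bool list \<Rightarrow> cantor set" where
  "cyl s = {x. \<forall>i<length s. x i = s ! i}"

lemma mem_cyl_prefix: "x \<in> cyl (map x [0..<n])"
  by (simp add: cyl_def)

lemma coordinate_clopen: "{x::cantor. x i = b} \<in> Omega"
proof -
  have c: "continuous_on UNIV (\<lambda>y::cantor. y i)"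
    by simp
  have eq: "{x::cantor. x i = b} = (\<lambda>y. y i) -` {b}"
    by auto
  have "open ((\<lambda>y::cantor. y i) -` {b})"
    by (intro open_vimage c Topological_Spaces.open_discrete)
  moreover have "closed ((\<lambda>y::cantor. y i) -` {b})"
    by (intro closed_vimage c closed_singleton)
  ultimately show ?thesis
    unfolding Omega_def eq by simp
qed

lemma Omega_Diff: "A \<in> Omega \<Longrightarrow> B \<in> Omega \<Longrightarrow> A - B \<in> Omega"
  and Omega_empty: "{} \<in> Omega"
  by (auto simp: Omega_def)

lemma Omega_UN: "finite I \<Longrightarrow> (\<And>i. i \<in> I \<Longrightarrow> A i \<in> Omega) \<Longrightarrow> (\<Union>i\<in>I. A i) \<in> Omega"
  by (auto simp: Omega_def)

lemma Omega_INT: "finite I \<Longrightarrow> (\<And>i. i \<in> I \<Longrightarrow> A i \<in> Omega) \<Longrightarrow> (\<Inter>i\<in>I. A i) \<in> Omega"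
  by (auto simp: Omega_def)

lemma cyl_clopen: "cyl s \<in> Omega"
proof -
  have "cyl s = (\<Inter>i\<in>{..<length s}. {x. x i = s ! i})"
    by (auto simp: cyl_def)
  then show ?thesis
    by (simp add: Omega_INT coordinate_clopen)
qed

lemma sets_cyl: "cyl s \<in> sets coin"
proof -
  have "cyl s = {x \<in> space coin. \<forall>i\<in>{..<length s}. x i \<in> {s ! i}}"
    by (auto simp: cyl_def)
  also have "\<dots> \<in> sets coin"
    by (intro sets.sets_Collect_finite_All sets_Collect_single') auto
  finally show ?thesis .
qed

lemma open_contains_cyl:
  assumes "open U" "x \<in> U"
  shows "\<exists>n. cyl (map x [0..<n]) \<subseteq> U"
proof -
  have "openin (product_topology (\<lambda>i. euclidean) UNIV) U"
    using assms(1) by (simp add: open_fun_def)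
  from product_topology_open_contains_basis[OF this assms(2)]
  obtain X where X: "x \<in> (\<Pi>\<^sub>E i\<in>UNIV. X i)" "finite {i. X i \<noteq> UNIV}"
    "(\<Pi>\<^sub>E i\<in>UNIV. X i) \<subseteq> U"
    by auto
  from X(2) obtain n where n: "\<And>i. X i \<noteq> UNIV \<Longrightarrow> i < n"
    by (auto simp: finite_nat_set_iff_bounded)
  have "cyl (map x [0..<n]) \<subseteq> (\<Pi>\<^sub>E i\<in>UNIV. X i)"
  proof
    fix y assume y: "y \<in> cyl (map x [0..<n])"
    have "y i \<in> X i" for i
      using X(1) n[of i] y by (cases "X i = UNIV") (auto simp: cyl_def PiE_iff)
    then show "y \<in> (\<Pi>\<^sub>E i\<in>UNIV. X i)"
      by auto
  qed
  with X(3) show ?thesis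
    by blast
qed

lemma open_eq_UN_cyl:
  assumes "open U"
  shows "U = (\<Union>s\<in>{s. cyl s \<subseteq> U}. cyl s)"
  using open_contains_cyl[OF assms] mem_cyl_prefix by blast

lemma sets_coin_open: "open U \<Longrightarrow> U \<in> sets coin"
  by (subst open_eq_UN_cyl, assumption) (rule sets.countable_UN', auto simp: sets_cyl)

lemma sets_coin_closed: "closed U \<Longrightarrow> U \<in> sets coin"
  using sets.compl_sets[OF sets_coin_open[of "- U"]] by (simp add: Compl_eq_Diff_UNIV[symmetric] open_Compl)

lemma sets_coin_Omega: "c \<in> Omega \<Longrightarrow> c \<in> sets coin"
  by (simp add: Omega_def sets_coin_open)

lemma compact_cantor: "compact (UNIV :: cantor set)"
proof -
  have "compact_space (euclidean :: bool topology)"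
    by (simp add: compact_space_def finite_imp_compact)
  then have "compact_space (product_topology (\<lambda>i::nat. euclidean :: bool topology) UNIV)"
    by (simp add: compact_space_product_topology)
  then show ?thesis
    by (simp only: euclidean_product_topology compact_space_def topspace_euclidean compactin_euclidean_iff)
qed

text \<open>By compactness a clopen set is a finite union of cylinders, and there are only countably
  many cylinders. This is what allows finite pieces of clopen sequences to be coded by lists of
  numbers.\<close>

lemma countable_Omega: "countable Omega"
proof -
  have "Omega \<subseteq> (\<lambda>F. \<Union>s\<in>F. cyl s) ` {F. finite F}"
  proof
    fix c assume c: "c \<in> Omega"
    then have "compact c"
      using compact_Int_closed[OF compact_cantor, of c] by (simp add: Omega_def)
    moreover have "\<And>s. s \<in> {s. cyl s \<subseteq> c} \<Longrightarrow> open (cyl s)"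
      using cyl_clopen by (auto simp: Omega_def)
    moreover have c_eq: "c = (\<Union>s\<in>{s. cyl s \<subseteq> c}. cyl s)"
      using c by (intro open_eq_UN_cyl) (simp add: Omega_def)
    ultimately obtain F where "F \<subseteq> {s. cyl s \<subseteq> c}" "finite F" "c \<subseteq> (\<Union>s\<in>F. cyl s)"
      by (metis (no_types, lifting) compactE_image order_refl)
    then have "c = (\<Union>s\<in>F. cyl s)"
      by auto
    with \<open>finite F\<close> show "c \<in> (\<lambda>F. \<Union>s\<in>F. cyl s) ` {F. finite F}"
      by blast
  qed
  then show ?thesis
    by (rule countable_subset) (intro countable_image countable_Collect_finite)
qed

text \<open>The regularity theorem needs a Polish space; \<^typ>\<open>bool\<close> is not an instance of
  that class, but the homeomorphic type \<^typ>\<open>bool discrete\<close> is.\<close>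

lemma null_ideal_outer_open:
  assumes "A \<in> null_ideal" "0 < e"
  shows "\<exists>U. open U \<and> A \<subseteq> U \<and> measure coin U < e"
proof -
  obtain B where B: "B \<in> null_sets coin" "A \<subseteq> B"
    using assms by (auto simp: null_ideal_iff)
  define f :: "cantor \<Rightarrow> nat \<Rightarrow> bool discrete" where "f x = (\<lambda>n. discrete (x n))" for x
  define g :: "(nat \<Rightarrow> bool discrete) \<Rightarrow> cantor" where "g y = (\<lambda>n. of_discrete (y n))" for y
  have gf: "g (f x) = x" for x
    by (simp add: f_def g_def discrete_inverse)
  have fg: "f (g x) = x" for x
    by (simp add: f_def g_def of_discrete_inverse)
  have contf: "continuous_on UNIV f"
    unfolding f_def
  proof (intro continuous_on_coordinatewise_then_product)
    fix n
    have "continuous_on UNIV (discrete \<circ> (\<lambda>x::cantor. x n))"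
      by (intro continuous_on_compose) auto
    then show "continuous_on UNIV (\<lambda>x::cantor. discrete (x n))"
      by (simp add: o_def)
  qed
  have open_f: "open (f -` U)" if "open U" for U
    using contf that by (rule open_vimage[rotated])
  have f[measurable]: "f \<in> measurable coin borel"
    by (rule borel_measurableI) (simp add: sets_coin_open open_f)
  have g: "g \<in> measurable borel coin"
    unfolding g_def
  proof (rule measurable_PiM_single')
    fix n :: nat
    have "(\<lambda>y::nat \<Rightarrow> bool discrete. y n) \<in> borel_measurable borel"
      by (intro borel_measurable_continuous_onI) simp
    moreover have "of_discrete \<in> measurable borel (measure_pmf (bernoulli_pmf (1/2)))"
      by (simp add: measurable_def borel_open Discrete_Topology.open_discrete)
    ultimately show "(\<lambda>y. of_discrete (y n)) \<in> measurable borel (measure_pmf (bernoulli_pmf (1/2)))"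
      by measurable
  qed auto
  let ?M = "distr coin borel f"
  have gB: "g -` B \<in> sets borel"
    using measurable_sets[OF g, of B] B by auto
  have fgB: "f -` (g -` B) = B"
    by (auto simp: gf)
  have "emeasure ?M (g -` B) = 0"
    using B gB by (simp add: emeasure_distr fgB null_setsD1)
  \<comment> \<open>Outer regularity applies to the image measure on the Polish space; open
    supersets pull back along the continuous \<open>f\<close>.\<close>
  moreover have "emeasure ?M (g -` B) = (INF U \<in> {U. g -` B \<subseteq> U \<and> open U}. emeasure ?M U)"
    using gB by (intro outer_regular) (auto simp: emeasure_distr coin.emeasure_space_1)
  ultimately have "(INF U \<in> {U. g -` B \<subseteq> U \<and> open U}. emeasure ?M U) < ennreal e"
    using assms(2) by simp
  then obtain U where U: "g -` B \<subseteq> U" "open U" "emeasure ?M U < ennreal e"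
    by (auto simp: INF_less_iff)
  show ?thesis
  proof (intro exI conjI)
    show "open (f -` U)"
      using U(2) by (rule open_f)
    show "A \<subseteq> f -` U"
      using B(2) U(1) fgB by blast
    have "emeasure coin (f -` U) < ennreal e"
      using U by (simp add: emeasure_distr)
    then show "measure coin (f -` U) < e"
      using assms(2) by (simp add: coin.P.emeasure_eq_measure ennreal_less_iff)
  qed
qed

section \<open>Limsup sets and coverings of null sets\<close>

lemma limsup_set_eq: "limsup_set E = (\<Inter>n. \<Union>m\<in>{n..}. E m)"
  by (auto simp: limsup_set_def INFM_nat_le)

lemma sets_limsup_set: "(\<And>n. E n \<in> sets coin) \<Longrightarrow> limsup_set E \<in> sets coin"
  unfolding limsup_set_eq by (intro sets.countable_INT sets.countable_UN' | blast | simp)+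

lemma limsup_set_null:
  assumes "\<And>n. E n \<in> sets coin" "\<And>n. measure coin (E n) \<le> (1/2) ^ n"
  shows "limsup_set E \<in> null_ideal"
proof -
  have "limsup E \<in> null_sets coin"
  proof (rule borel_cantelli_limsup1[OF assms(1)])
    show "summable (\<lambda>n. measure coin (E n))"
      by (rule summable_comparison_test'[OF summable_geometric, of "1/2" 0]) (simp_all add: assms(2))
  qed (simp add: coin.P.emeasure_eq_measure)
  then show ?thesis
    by (auto simp: null_ideal_iff limsup_set_eq limsup_INF_SUP)
qed

text \<open>Cover \<open>A\<close> by open sets \<open>U n\<close> of measure below
  \<open>(1/2) ^ n\<close>, cut each into disjoint clopen pieces and list all pieces in one
  sequence. A point lies in at most one piece of each \<open>U n\<close>, so the limsup of the list
  stays inside that of \<open>U\<close>.\<close>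

lemma null_subset_limsup_set:
  assumes "A \<in> null_ideal"
  shows "\<exists>c\<in>Omega_bar. A \<subseteq> limsup_set c"
proof -
  have "\<exists>U. open U \<and> A \<subseteq> U \<and> measure coin U < (1/2) ^ n" for n :: nat
    by (rule null_ideal_outer_open[OF assms]) simp
  then obtain U where U: "\<And>n. open (U n)" "\<And>n. A \<subseteq> U n"
    "\<And>n. measure coin (U n) < (1/2) ^ n"
    by metis
  \<comment> \<open>\<open>from_nat\<close> runs through all finite bit lists.
    \<open>disjointed\<close> subtracts only finitely many earlier sets, so each
    \<open>D n k\<close> remains clopen.\<close>
  define C where "C n k = (if cyl (from_nat k) \<subseteq> U n then cyl (from_nat k) else {})" for n k
  define D where "D n = disjointed (C n)" for n
  define c where "c m = (case prod_decode m of (n, k) \<Rightarrow> D n k)" for m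
  have UD: "U n = (\<Union>k. D n k)" for n
  proof -
    have "U n \<subseteq> (\<Union>k. C n k)"
    proof
      fix x assume "x \<in> U n"
      then obtain s where "cyl s \<subseteq> U n" "x \<in> cyl s"
        using open_eq_UN_cyl[OF U(1)] by blast
      then show "x \<in> (\<Union>k. C n k)"
        by (intro UN_I[of "to_nat s"]) (auto simp: C_def)
    qed
    then show ?thesis
      unfolding D_def UN_disjointed_eq by (auto simp: C_def split: if_splits)
  qed
  have D_unique: "k = l" if "x \<in> D n k" "x \<in> D n l" for x n k l
    using that disjoint_family_disjointed[of "C n"]
    by (auto simp: D_def disjoint_family_on_def)
  have C_clopen: "C n k \<in> Omega" for n k
    by (simp add: C_def cyl_clopen Omega_empty)
  have D_clopen: "D n k \<in> Omega" for n k
    unfolding D_def disjointed_def by (intro Omega_Diff Omega_UN C_clopen) simp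
  have "limsup_set c \<subseteq> limsup_set U"
  proof
    fix x assume "x \<in> limsup_set c"
    then have inf: "infinite {m. x \<in> c m}"
      by (simp add: limsup_set_def frequently_cofinite)
    have "infinite {n. x \<in> U n}"
    proof
      assume fin: "finite {n. x \<in> U n}"
      have "finite {k. x \<in> D n k}" for n
      proof (rule finite_subset)
        show "{k. x \<in> D n k} \<subseteq> {SOME k. x \<in> D n k}"
          using D_unique[OF _ someI[of "\<lambda>k. x \<in> D n k"]] by blast
      qed simp
      with fin have "finite (prod_encode ` (SIGMA n:{n. x \<in> U n}. {k. x \<in> D n k}))"
        by blast
      moreover have "{m. x \<in> c m} \<subseteq> prod_encode ` (SIGMA n:{n. x \<in> U n}. {k. x \<in> D n k})"
      proof
        fix m assume "m \<in> {m. x \<in> c m}"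
        moreover obtain n k where nk: "prod_decode m = (n, k)"
          by fastforce
        ultimately have "x \<in> D n k"
          by (simp add: c_def)
        moreover have "m = prod_encode (n, k)"
          by (simp flip: nk)
        ultimately show "m \<in> prod_encode ` (SIGMA n:{n. x \<in> U n}. {k. x \<in> D n k})"
          using UD by auto
      qed
      ultimately show False
        using inf finite_subset by blast
    qed
    then show "x \<in> limsup_set U"
      by (simp add: limsup_set_def frequently_cofinite)
  qed
  moreover have "limsup_set U \<in> null_ideal"
    using U by (intro limsup_set_null sets_coin_open) (auto intro: less_imp_le)
  ultimately have "limsup_set c \<in> null_ideal"
    by (rule null_ideal_subset[rotated])
  moreover have "c m \<in> Omega" for m
    by (simp add: c_def D_clopen split: prod.split)
  moreover have "A \<subseteq> limsup_set c"
  proof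
    fix x assume "x \<in> A"
    then have "\<forall>n. \<exists>k. x \<in> D n k"
      using U(2) UD by blast
    then obtain k where k: "\<And>n. x \<in> D n (k n)"
      by metis
    have "inj (\<lambda>n. prod_encode (n, k n))"
      by (auto intro!: injI)
    then have "infinite (range (\<lambda>n. prod_encode (n, k n)))"
      by (rule range_inj_infinite)
    moreover have "range (\<lambda>n. prod_encode (n, k n)) \<subseteq> {m. x \<in> c m}"
      using k by (auto simp: c_def)
    ultimately have "infinite {m. x \<in> c m}"
      using finite_subset by blast
    then show "x \<in> limsup_set c"
      by (simp add: limsup_set_def frequently_cofinite)
  qed
  ultimately show ?thesis
    by (auto simp: Omega_bar_def null_ideal_def)
qed

section \<open>Independent blocks of coordinates\<close>

text \<open>The injective coding gives each pair \<open>(n, i)\<close> its own \<open>n\<close>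
  coordinates; hence the independence.\<close>

definition blk :: "nat \<Rightarrow> 'a::countable \<Rightarrow> cantor set" where
  "blk n i = {x. \<forall>j<n. x (to_nat (n, i, j))}"

lemma blk_clopen: "blk n i \<in> Omega"
proof -
  have "blk n i = (\<Inter>j\<in>{..<n}. {x. x (to_nat (n, i, j)) = True})"
    by (auto simp: blk_def)
  then show ?thesis
    by (simp only: Omega_INT coordinate_clopen finite_lessThan)
qed

lemma measure_INT_blk:
  assumes "finite J"
  shows "measure coin (\<Inter>i\<in>J. blk n i) = ((1/2) ^ n) ^ card J"
proof -
  let ?k = "\<lambda>(i, j). to_nat (n, i, j)"
  let ?I = "?k ` (J \<times> {..<n})"
  have fin: "finite ?I"
    using assms by blast
  have "card ?I = card (J \<times> {..<n})"
    by (intro card_image inj_onI) auto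
  then have card: "card ?I = n * card J"
    by (simp add: card_cartesian_product)
  have "(\<Inter>i\<in>J. blk n i) = {x \<in> space coin. \<forall>k\<in>?I. x k \<in> {True}}"
    by (auto simp: blk_def)
  also have "emeasure coin \<dots> = (\<Prod>k\<in>?I. emeasure (measure_pmf (bernoulli_pmf (1/2))) {True})"
    using fin by (intro coin.emeasure_PiM_Collect) auto
  also have "\<dots> = ennreal ((1/2) ^ card ?I)"
    by (simp add: emeasure_pmf_single ennreal_power del: ennreal_half)
  finally show ?thesis
    unfolding measure_def card by (simp add: power_mult)
qed

text \<open>Independence of events passes to the sigma-algebras they generate, hence to their
  complements.\<close>

lemma measure_INT_compl_blk:
  assumes "finite J"
  shows "measure coin (\<Inter>i\<in>J. - blk n i) = (1 - (1/2) ^ n) ^ card J"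
proof (cases "J = {}")
  case True
  then show ?thesis
    using coin.P.prob_space by simp
next
  case False
  have one: "measure coin (blk n i) = (1/2) ^ n" for i :: 'a
    using measure_INT_blk[of "{i}" n] by simp
  have sets: "blk n i \<in> sets coin" for i :: 'a
    by (intro sets_coin_Omega blk_clopen)
  have "coin.P.indep_events (blk n) J"
  proof (rule coin.P.indep_eventsI)
    fix L assume "L \<subseteq> J" "finite L"
    then show "measure coin (\<Inter>i\<in>L. blk n i) = (\<Prod>i\<in>L. measure coin (blk n i))"
      by (simp add: measure_INT_blk one)
  qed (rule sets)
  then have "coin.P.indep_sets (\<lambda>i. sigma_sets (space coin) {blk n i}) J"
    unfolding coin.P.indep_events_def_alt
    by (rule coin.P.indep_sets_sigma) (simp add: Int_stable_def)
  moreover have "\<forall>i\<in>J. - blk n i \<in> sigma_sets (space coin) {blk n i}"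
    by (auto simp: Compl_eq_Diff_UNIV intro: sigma_sets.intros simp del: Diff_UNIV)
  ultimately have "measure coin (\<Inter>i\<in>J. - blk n i) = (\<Prod>i\<in>J. measure coin (- blk n i))"
    using assms False by (intro coin.P.indep_setsD) auto
  also have "\<dots> = (\<Prod>i\<in>J. 1 - (1/2) ^ n)"
    using coin.P.prob_compl[OF sets] by (intro prod.cong refl) (simp add: Compl_eq_Diff_UNIV one)
  finally show ?thesis
    by simp
qed

section \<open>Baire category and capture by slaloms\<close>

text \<open>Otherwise every \<open>K \<inter> T m\<close> would be open and dense in the compact
  Hausdorff space \<open>K\<close>, and by the Baire category theorem their empty intersection would
  be dense too.\<close>

lemma closed_Baire_cyl:
  assumes "closed K" "K \<noteq> {}" "\<And>m::nat. open (T m)" "K \<inter> (\<Inter>m. T m) = {}"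
  shows "\<exists>m s. K \<inter> cyl s \<noteq> {} \<and> K \<inter> cyl s \<inter> T m = {}"
proof (rule ccontr)
  assume neg: "\<not> ?thesis"
  let ?X = "top_of_set K"
  have "compact K"
    using compact_Int_closed[OF compact_cantor assms(1)] by simp
  then have cpt: "compact_space ?X"
    by (simp add: compact_space_subtopology)
  have "Hausdorff_space (euclidean :: cantor topology)"
    unfolding Hausdorff_space_def
  proof (intro allI impI)
    fix x y :: cantor assume "x \<in> topspace euclidean \<and> y \<in> topspace euclidean \<and> x \<noteq> y"
    then obtain i where "x i \<noteq> y i"
      by auto
    then show "\<exists>U V. openin euclidean U \<and> openin euclidean V \<and> x \<in> U \<and> y \<in> V \<and> disjnt U V"
      using coordinate_clopen
      by (intro exI[of _ "{z. z i = x i}"] exI[of _ "{z. z i = y i}"])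
        (auto simp: Omega_def disjnt_def)
  qed
  then have "Hausdorff_space ?X"
    by (rule Hausdorff_space_subtopology)
  then have lc: "locally_compact_space ?X \<and> regular_space ?X"
    using cpt by (simp add: compact_Hausdorff_imp_regular_space compact_imp_locally_compact_space)
  have "?X closure_of \<Inter>(range (\<lambda>m. K \<inter> T m)) = topspace ?X"
  proof (rule Baire_category)
    fix S assume "S \<in> range (\<lambda>m. K \<inter> T m)"
    then obtain m where S: "S = K \<inter> T m"
      by auto
    have "S \<inter> V \<noteq> {}" if V: "openin ?X V" "V \<noteq> {}" for V
    proof -
      obtain W where W: "open W" "V = K \<inter> W"
        using V(1) by (auto simp: openin_open)
      with V(2) obtain x where x: "x \<in> K" "x \<in> W"
        by auto
      then obtain n where n: "cyl (map x [0..<n]) \<subseteq> W"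
        using open_contains_cyl[OF W(1)] by blast
      have "K \<inter> cyl (map x [0..<n]) \<noteq> {}"
        using x mem_cyl_prefix by blast
      then have "K \<inter> cyl (map x [0..<n]) \<inter> T m \<noteq> {}"
        using neg by blast
      with n W S show ?thesis
        by blast
    qed
    then have "?X closure_of S = topspace ?X"
      unfolding dense_intersects_open by blast
    then show "openin ?X S \<and> ?X closure_of S = topspace ?X"
      using assms(3) by (auto simp: S openin_open)
  qed (use lc in auto)
  moreover have "\<Inter>(range (\<lambda>m. K \<inter> T m)) = {}"
    using assms(4) by blast
  ultimately show False
    using assms(2) by simp
qed

text \<open>From the complement of an open cover of \<open>A\<close> of measure below 1, delete all
  cylinders meeting it in a null set. There are countably many of these, so no measure is lost, and
  every surviving portion has positive measure.\<close>

lemma null_avoiding_closed: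
  assumes "A \<in> null_ideal"
  shows "\<exists>K. closed K \<and> K \<noteq> {} \<and> K \<inter> A = {} \<and>
    (\<forall>s. K \<inter> cyl s \<noteq> {} \<longrightarrow> 0 < measure coin (K \<inter> cyl s))"
proof -
  obtain U where U: "open U" "A \<subseteq> U" "measure coin U < 1"
    using null_ideal_outer_open[OF assms, of 1] by auto
  define Z where "Z = (\<Union>s\<in>{s. measure coin (- U \<inter> cyl s) = 0}. cyl s)"
  define K where "K = - U - Z"
  have U_sets: "- U \<in> sets coin"
    using U(1) by (intro sets_coin_closed) auto
  have "open Z"
    using cyl_clopen by (auto simp: Z_def Omega_def)
  then have K_closed: "closed K"
    using U(1) by (simp add: K_def closed_Diff closed_Compl)
  have "(\<Union>s\<in>{s. measure coin (- U \<inter> cyl s) = 0}. - U \<inter> cyl s) \<in> null_sets coin"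
    using U_sets sets_cyl
    by (intro null_sets_UN') (auto simp: null_sets_def coin.P.emeasure_eq_measure)
  then have null: "- U \<inter> Z \<in> null_sets coin"
    by (simp only: Z_def Int_UN_distrib)
  have K_eq: "measure coin (K \<inter> V) = measure coin (- U \<inter> V)" if "V \<in> sets coin" for V
  proof -
    have "K \<inter> V = (- U \<inter> V) - (- U \<inter> Z)"
      by (auto simp: K_def)
    then show ?thesis
      using measure_Diff_null_set[OF _ null, of "- U \<inter> V"] U_sets that by auto
  qed
  have "measure coin (- U) = 1 - measure coin U"
    using coin.P.prob_compl[OF sets_coin_open[OF U(1)]] by (simp add: Compl_eq_Diff_UNIV)
  then have "0 < measure coin K"
    using K_eq[of UNIV] sets.top[of coin] U(3) by simp
  then have "K \<noteq> {}"
    by auto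
  moreover have "0 < measure coin (K \<inter> cyl s)" if "K \<inter> cyl s \<noteq> {}" for s
  proof -
    have "measure coin (- U \<inter> cyl s) \<noteq> 0"
      using that by (auto simp: K_def Z_def)
    then show ?thesis
      by (simp add: K_eq sets_cyl zero_less_measure_iff)
  qed
  moreover have "K \<inter> A = {}"
    using U(2) by (auto simp: K_def)
  ultimately show ?thesis
    using K_closed by blast
qed

lemma limsup_blk_null: "limsup_set (\<lambda>n. blk n (f n)) \<in> null_ideal"
proof (rule limsup_set_null)
  show "measure coin (blk n (f n)) \<le> (1/2) ^ n" for n
    using measure_INT_blk[of "{f n}" n] by simp
qed (intro sets_coin_Omega blk_clopen)

text \<open>By the assumption on \<open>t\<close>, any \<open>t n\<close> complements of blocks at
  level \<open>n\<close> meet in a set of measure below \<open>1 / (real n + 1)\<close>. So a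
  portion of \<open>K\<close> of at least that measure misses fewer than \<open>t n\<close> of the
  sets \<open>blk n i\<close>.\<close>

lemma null_localizes:
  fixes t :: "nat \<Rightarrow> nat"
  assumes t: "\<And>n. (1 - (1/2) ^ n) ^ t n < 1 / (real n + 1)" and A: "A \<in> null_ideal"
  shows "\<exists>S :: nat \<Rightarrow> 'a::countable set. (\<forall>n. finite (S n) \<and> card (S n) \<le> (n + 1) * t n) \<and>
    (\<forall>f. limsup_set (\<lambda>n. blk n (f n)) \<subseteq> A \<longrightarrow> (\<forall>\<^sub>\<infinity>n. f n \<in> S n))"
proof -
  obtain K where K: "closed K" "K \<noteq> {}" "K \<inter> A = {}"
    "\<And>s. K \<inter> cyl s \<noteq> {} \<Longrightarrow> 0 < measure coin (K \<inter> cyl s)"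
    using null_avoiding_closed[OF A] by blast
  define R :: "nat \<Rightarrow> nat \<Rightarrow> 'a set"
    where "R j n = {i. K \<inter> cyl (from_nat j) \<inter> blk n i = {}}" for j n
  \<comment> \<open>Oversized sets are emptied so that the width bound holds for all
    \<open>n\<close>; an empty portion, for instance, misses every block.\<close>
  define R' where "R' n j = (if finite (R j n) \<and> card (R j n) \<le> t n then R j n else {})" for n j
  \<comment> \<open>Stage \<open>n\<close> uses the portions with code at most \<open>n\<close>:
    this gives the factor \<open>n + 1\<close>, and every portion enters eventually.\<close>
  define S where "S n = (\<Union>j\<le>n. R' n j)" for n
  have fin: "finite (R' n j)" and card: "card (R' n j) \<le> t n" for n j
    by (auto simp: R'_def)
  have "finite (S n) \<and> card (S n) \<le> (n + 1) * t n" for n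
  proof
    show "finite (S n)"
      by (simp add: S_def fin)
    have "card (S n) \<le> (\<Sum>j\<le>n. card (R' n j))"
      unfolding S_def by (rule card_UN_le) simp
    also have "\<dots> \<le> (\<Sum>j\<le>n. t n)"
      by (intro sum_mono card)
    finally show "card (S n) \<le> (n + 1) * t n"
      by simp
  qed
  moreover have "\<forall>\<^sub>\<infinity>n. f n \<in> S n" if f: "limsup_set (\<lambda>n. blk n (f n)) \<subseteq> A" for f
  proof -
    \<comment> \<open>The coded limsup lies in \<open>A\<close> and so misses \<open>K\<close>;
      Baire then yields a portion missing all blocks from some \<open>m\<close> on.\<close>
    have "K \<inter> (\<Inter>m. \<Union>n\<in>{m..}. blk n (f n)) = {}"
      using f K(3) by (auto simp: limsup_set_eq)
    moreover have "open (\<Union>n\<in>{m..}. blk n (f n))" for m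
      using blk_clopen by (auto simp: Omega_def)
    ultimately obtain m s where ms: "K \<inter> cyl s \<noteq> {}" "K \<inter> cyl s \<inter> (\<Union>n\<in>{m..}. blk n (f n)) = {}"
      using closed_Baire_cyl[OF K(1,2), of "\<lambda>m. \<Union>n\<in>{m..}. blk n (f n)"] by blast
    define \<delta> where "\<delta> = measure coin (K \<inter> cyl s)"
    have "0 < \<delta>"
      using K(4)[OF ms(1)] by (simp add: \<delta>_def)
    \<comment> \<open>From \<open>N\<close> on, \<open>1 / (real n + 1)\<close> is below the measure
      of this portion.\<close>
    then obtain N where N: "1 / (real N + 1) < \<delta>"
      using reals_Archimedean[of \<delta>] by (auto simp: inverse_eq_divide add.commute)
    have "f n \<in> S n" if n: "n \<ge> m" "n \<ge> N" "n \<ge> to_nat s" for n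
    proof -
      have "1 / (real n + 1) \<le> 1 / (real N + 1)"
        using n(2) by (simp add: frac_le)
      with N t[of n] have lt: "(1 - (1/2) ^ n) ^ t n < \<delta>"
        by linarith
      have no: "\<not> (J \<subseteq> R (to_nat s) n \<and> finite J \<and> card J = t n)" for J
      proof
        assume J: "J \<subseteq> R (to_nat s) n \<and> finite J \<and> card J = t n"
        then have "K \<inter> cyl s \<subseteq> (\<Inter>i\<in>J. - blk n i)"
          by (auto simp: R_def)
        moreover have "(\<Inter>i\<in>J. - blk n i) \<in> sets coin"
          using J blk_clopen by (intro sets_coin_closed closed_INT) (auto simp: Omega_def)
        ultimately have "\<delta> \<le> measure coin (\<Inter>i\<in>J. - blk n i)"
          unfolding \<delta>_def by (rule coin.P.finite_measure_mono)
        also have "\<dots> < \<delta>"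
          using J lt by (simp add: measure_INT_compl_blk)
        finally show False by simp
      qed
      have "finite (R (to_nat s) n)"
        using no infinite_arbitrarily_large by blast
      moreover have "card (R (to_nat s) n) \<le> t n"
        using no obtain_subset_with_card_n by (metis nat_le_linear)
      moreover have "f n \<in> R (to_nat s) n"
        using ms(2) n(1) by (auto simp: R_def)
      ultimately have "f n \<in> R' n (to_nat s)"
        by (simp add: R'_def)
      with n(3) show ?thesis
        by (auto simp: S_def)
    qed
    then show ?thesis
      unfolding MOST_nat_le by (intro exI[of _ "max m (max N (to_nat s))"]) auto
  qed
  ultimately show ?thesis
    by blast
qed

section \<open>Bounding sequences in \<open>Omega_bar\<close>\<close>

lemma Omega_bar_iff: "c \<in> Omega_bar \<longleftrightarrow> (\<forall>n. c n \<in> Omega) \<and> limsup_set c \<in> null_ideal"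
  by (simp add: Omega_bar_def null_ideal_def)

text \<open>The unions of the tails decrease to the null limsup, so their measures tend to 0 by
  continuity from above.\<close>

lemma Omega_bar_tails:
  assumes "c \<in> Omega_bar" "\<And>k::nat. 0 < \<epsilon> k"
  shows "\<exists>f. strict_mono f \<and> (\<forall>k. measure coin (\<Union>m\<in>{f k..}. c m) \<le> \<epsilon> k)"
proof -
  let ?T = "\<lambda>n. \<Union>m\<in>{n..}. c m"
  have c: "c n \<in> sets coin" for n
    using assms(1) by (auto simp: Omega_bar_iff intro: sets_coin_Omega)
  have sets: "?T n \<in> sets coin" for n
    using c by auto
  have "limsup_set c \<in> null_sets coin"
    using assms(1) null_sets_completion_iff[OF sets_limsup_set[OF c]]
    by (simp add: Omega_bar_def cantor_measure_def)
  then have "measure coin (\<Inter>n. ?T n) = 0"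
    by (simp add: limsup_set_eq measure_eq_0_null_sets)
  moreover have "decseq ?T"
    by (force simp: decseq_def)
  ultimately have lim: "(\<lambda>n. measure coin (?T n)) \<longlonglongrightarrow> 0"
    using coin.P.finite_Lim_measure_decseq[of ?T] sets by auto
  have "\<exists>N. \<forall>n\<ge>N. measure coin (?T n) < \<epsilon> k" for k
    using order_tendstoD(2)[OF lim assms(2)[of k]] by (simp add: eventually_sequentially)
  then obtain N where N: "\<And>k n. n \<ge> N k \<Longrightarrow> measure coin (?T n) < \<epsilon> k"
    by metis
  \<comment> \<open>The summand \<open>k\<close> makes \<open>f\<close> strictly increasing; the sum
    makes \<open>f k\<close> at least \<open>N k\<close>.\<close>
  define f where "f k = k + (\<Sum>i\<le>k. N i)" for k
  have "N k \<le> f k" for k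
    using member_le_sum[of k "{..k}" N] by (simp add: f_def)
  then have "\<forall>k. measure coin (?T (f k)) \<le> \<epsilon> k"
    using N by (auto intro: less_imp_le)
  moreover have "strict_mono f"
    by (simp add: strict_mono_Suc_iff f_def)
  ultimately show ?thesis
    by blast
qed

lemma strict_mono_bracket:
  fixes f :: "nat \<Rightarrow> nat"
  assumes "strict_mono f" "f k0 \<le> m"
  shows "\<exists>k\<ge>k0. f k \<le> m \<and> m < f (Suc k)"
proof -
  define q where "q = (LEAST q. m < f q)"
  have "m < f (Suc m)"
    using strict_mono_imp_increasing[OF assms(1), of "Suc m"] by simp
  then have q: "m < f q"
    unfolding q_def by (rule LeastI)
  have "k0 < q"
    using assms q by (metis le_less_trans strict_mono_less)
  then obtain k where k: "q = Suc k"
    by (cases q) auto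
  then have "\<not> m < f k"
    using not_less_Least[of k "\<lambda>q. m < f q"] by (simp add: q_def)
  then show ?thesis
    using k q \<open>k0 < q\<close> by (intro exI[of _ k]) auto
qed

text \<open>This is a Tukey connection: since \<open>d\<close> depends on \<open>A\<close> alone, it
  serves both cardinals.\<close>

lemma Omega_bar_null_connection:
  "\<exists>\<Phi>. (\<forall>c\<in>Omega_bar. \<Phi> c \<in> null_ideal) \<and>
    (\<forall>A\<in>null_ideal. \<exists>d\<in>Omega_bar. \<forall>c\<in>Omega_bar. \<Phi> c \<subseteq> A \<longrightarrow> c \<subseteq>\<^sub>F\<^sub>i\<^sub>n d)"
proof -
  have "\<exists>t. (1 - (1/2) ^ n) ^ t < 1 / (real n + 1)" for n
    by (rule real_arch_pow_inv) auto
  then obtain t where t: "\<And>n. (1 - (1/2) ^ n) ^ t n < 1 / (real n + 1)"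
    by metis
  \<comment> \<open>A slalom has at most \<open>(k + 1) * t k\<close> entries at stage
    \<open>k\<close>, so entries of measure at most \<open>\<epsilon> k\<close> have a union of
    measure at most \<open>(1/2) ^ k\<close>.\<close>
  define \<epsilon> where "\<epsilon> k = (1/2) ^ k / (real ((k + 1) * t k) + 1)" for k
  have \<epsilon>_pos: "0 < \<epsilon> k" for k
    by (simp add: \<epsilon>_def add_nonneg_pos)
  define code where "code = to_nat_on Omega"
  define e where "e = from_nat_into Omega"
  have e_code: "e (code c) = c" if "c \<in> Omega" for c
    using that by (simp add: e_def code_def countable_Omega)
  \<comment> \<open>\<open>Omega\<close> is nonempty, so every number decodes to a clopen set, even
    one that is not a code.\<close>
  have e_clopen: "e i \<in> Omega" for i
    using from_nat_into[of Omega i] Omega_empty by (auto simp: e_def)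
  have e_sets: "e i \<in> sets coin" for i
    by (intro sets_coin_Omega e_clopen)
  have "\<forall>c\<in>Omega_bar. \<exists>f. strict_mono f \<and> (\<forall>k. measure coin (\<Union>m\<in>{f k..}. c m) \<le> \<epsilon> k)"
    using Omega_bar_tails \<epsilon>_pos by blast
  then obtain F where F: "\<And>c. c \<in> Omega_bar \<Longrightarrow> strict_mono (F c)"
    "\<And>c k. c \<in> Omega_bar \<Longrightarrow> measure coin (\<Union>m\<in>{F c k..}. c m) \<le> \<epsilon> k"
    by metis
  \<comment> \<open>The start \<open>F c k\<close> is recorded so that positions can be recovered
    from the code alone.\<close>
  define h :: "(nat \<Rightarrow> cantor set) \<Rightarrow> nat \<Rightarrow> nat \<times> nat list"
    where "h c k = (F c k, map (\<lambda>m. code (c m)) [F c k..<F c (Suc k)])" for c k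
  define \<Phi> where "\<Phi> c = limsup_set (\<lambda>k. blk k (h c k))" for c
  have "\<exists>d\<in>Omega_bar. \<forall>c\<in>Omega_bar. \<Phi> c \<subseteq> A \<longrightarrow> c \<subseteq>\<^sub>F\<^sub>i\<^sub>n d" if A: "A \<in> null_ideal" for A
  proof -
    obtain S :: "nat \<Rightarrow> (nat \<times> nat list) set"
      where S: "\<forall>n. finite (S n) \<and> card (S n) \<le> (n + 1) * t n"
        "\<forall>f. limsup_set (\<lambda>n. blk n (f n)) \<subseteq> A \<longrightarrow> (\<forall>\<^sub>\<infinity>n. f n \<in> S n)"
      using null_localizes[OF t A] by blast
    \<comment> \<open>Only small candidates are kept; the true pieces of a sequence \<open>c\<close>
      are small by the choice of \<open>F c\<close>.\<close>
    define W where "W k = {p \<in> S k. measure coin (\<Union>i\<in>set (snd p). e i) \<le> \<epsilon> k}" for k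
    \<comment> \<open>All candidates covering position \<open>m\<close> contribute their entry
      there. The bound \<open>k \<le> m\<close> keeps the union finite, hence clopen; true pieces
      satisfy it because \<open>k \<le> F c k\<close>.\<close>
    define d where "d m = (\<Union>k\<le>m. \<Union>p\<in>{p \<in> W k. fst p \<le> m \<and> m < fst p + length (snd p)}.
      e (snd p ! (m - fst p)))" for m
    define E where "E k = (\<Union>p\<in>W k. \<Union>i\<in>set (snd p). e i)" for k
    have W_fin: "finite (W k)" and W_card: "card (W k) \<le> (k + 1) * t k" for k
      using S(1)[rule_format, of k] card_mono[of "S k" "W k"] by (auto simp: W_def)
    have E_sets: "E k \<in> sets coin" for k
      unfolding E_def using W_fin e_sets by (intro sets.finite_UN) auto
    have E_measure: "measure coin (E k) \<le> (1/2) ^ k" for k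
    proof -
      have "measure coin (E k) \<le> (\<Sum>p\<in>W k. measure coin (\<Union>i\<in>set (snd p). e i))"
        unfolding E_def using W_fin e_sets
        by (intro coin.P.finite_measure_subadditive_finite) (auto intro!: sets.finite_UN)
      also have "\<dots> \<le> (\<Sum>p\<in>W k. \<epsilon> k)"
        by (intro sum_mono) (simp add: W_def)
      also have "\<dots> \<le> real ((k + 1) * t k) * \<epsilon> k"
        using W_card[of k] \<epsilon>_pos[of k] by (simp only: sum_constant of_nat_le_iff mult_right_mono less_imp_le)
      also have "\<dots> \<le> (real ((k + 1) * t k) + 1) * \<epsilon> k"
        using \<epsilon>_pos[of k] by (intro mult_right_mono) auto
      also have "\<dots> = (1/2) ^ k"
      proof -
        have "real ((k + 1) * t k) + 1 \<noteq> 0"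
          by (metis add_nonneg_pos less_irrefl of_nat_0_le_iff zero_less_one)
        then show ?thesis
          unfolding \<epsilon>_def by (metis nonzero_mult_div_cancel_left times_divide_eq_right)
      qed
      finally show ?thesis .
    qed
    \<comment> \<open>For fixed \<open>k\<close> the finitely many lists in \<open>W k\<close> reach
      finitely many positions, so infinitely many \<open>m\<close> require infinitely many
      \<open>k\<close>.\<close>
    have "limsup_set d \<subseteq> limsup_set E"
    proof
      fix x assume "x \<in> limsup_set d"
      then have inf: "infinite {m. x \<in> d m}"
        by (simp add: limsup_set_def frequently_cofinite)
      have "{m. x \<in> d m} \<subseteq> (\<Union>k\<in>{k. x \<in> E k}. \<Union>p\<in>W k. {..<fst p + length (snd p)})"
      proof
        fix m assume "m \<in> {m. x \<in> d m}"
        then obtain k p where p: "p \<in> W k" "fst p \<le> m" "m < fst p + length (snd p)"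
          "x \<in> e (snd p ! (m - fst p))"
          by (auto simp: d_def)
        then have "snd p ! (m - fst p) \<in> set (snd p)"
          by (intro nth_mem) linarith
        with p have "x \<in> E k"
          unfolding E_def by blast
        with p show "m \<in> (\<Union>k\<in>{k. x \<in> E k}. \<Union>p\<in>W k. {..<fst p + length (snd p)})"
          by blast
      qed
      with inf W_fin have "infinite {k. x \<in> E k}"
        by (metis (no_types, lifting) finite_UN_I finite_lessThan finite_subset)
      then show "x \<in> limsup_set E"
        by (simp add: limsup_set_def frequently_cofinite)
    qed
    then have "limsup_set d \<in> null_ideal"
      using limsup_set_null[OF E_sets E_measure] null_ideal_subset by blast
    moreover have "d m \<in> Omega" for m
      unfolding d_def using W_fin by (intro Omega_UN e_clopen) auto
    ultimately have "d \<in> Omega_bar"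
      by (simp add: Omega_bar_iff)
    moreover have "c \<subseteq>\<^sub>F\<^sub>i\<^sub>n d" if c: "c \<in> Omega_bar" "\<Phi> c \<subseteq> A" for c
    proof -
      have "\<forall>\<^sub>\<infinity>k. h c k \<in> S k"
        using S(2) c(2) by (simp add: \<Phi>_def)
      then obtain k0 where k0: "\<And>k. k \<ge> k0 \<Longrightarrow> h c k \<in> S k"
        by (auto simp: MOST_nat_le)
      have c_clopen: "c m \<in> Omega" for m
        using c(1) by (simp add: Omega_bar_iff)
      \<comment> \<open>From \<open>F c k0\<close> on, each position lies in a piece whose code is
        listed in the slalom.\<close>
      have "c m \<subseteq> d m" if m: "m \<ge> F c k0" for m
      proof -
        obtain k where k: "k \<ge> k0" "F c k \<le> m" "m < F c (Suc k)"
          using strict_mono_bracket[OF F(1)[OF c(1)] m] by blast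
        have "(\<Union>i\<in>set (snd (h c k)). e i) \<subseteq> (\<Union>m\<in>{F c k..}. c m)"
          using e_code c_clopen by (auto simp: h_def)
        then have "measure coin (\<Union>i\<in>set (snd (h c k)). e i) \<le> measure coin (\<Union>m\<in>{F c k..}. c m)"
          using c_clopen by (intro coin.P.finite_measure_mono sets.countable_UN') (auto intro: sets_coin_Omega)
        also have "\<dots> \<le> \<epsilon> k"
          by (rule F(2)[OF c(1)])
        finally have "h c k \<in> W k"
          using k0[OF k(1)] by (simp add: W_def)
        moreover have "k \<le> m"
          using strict_mono_imp_increasing[OF F(1)[OF c(1)], of k] k(2) by linarith
        moreover have "fst (h c k) \<le> m \<and> m < fst (h c k) + length (snd (h c k))"
          using k by (simp add: h_def)
        moreover have "e (snd (h c k) ! (m - fst (h c k))) = c m"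
          using k e_code[OF c_clopen] nth_upt[of "F c k" "m - F c k" "F c (Suc k)"]
          by (simp add: h_def)
        ultimately show ?thesis
          unfolding d_def by blast
      qed
      then show ?thesis
        unfolding subseteq_Fin_def MOST_nat_le by blast
    qed
    ultimately show ?thesis
      by blast
  qed
  moreover have "\<Phi> c \<in> null_ideal" for c
    unfolding \<Phi>_def by (rule limsup_blk_null)
  ultimately show ?thesis
    by blast
qed

section \<open>Comparison of the cardinals\<close>

lemma subseteq_Fin_limsup_mono: "c \<subseteq>\<^sub>F\<^sub>i\<^sub>n d \<Longrightarrow> limsup_set c \<subseteq> limsup_set d"
  unfolding subseteq_Fin_def limsup_set_def
  by (auto elim!: frequently_rev_mp eventually_mono)

text \<open>An image is never larger than its source, so it suffices to transport a smallest witness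
  of \<open>P\<close>.\<close>

lemma least_size_image_le:
  assumes "\<exists>A. P A" "\<And>A. P A \<Longrightarrow> Q (f ` A)"
  shows "least_size Q \<le>o least_size P"
proof -
  obtain A where A: "P A" "least_size P = |A|"
    using least_size_attained[of P] assms(1) by blast
  obtain B where B: "least_size Q = |B|" "\<And>C. Q C \<Longrightarrow> |B| \<le>o |C|"
    using least_size_attained[of Q] assms(2)[OF A(1)] by blast
  have "|B| \<le>o |f ` A|"
    using A(1) assms(2) B(2) by blast
  then show ?thesis
    unfolding A(2) B(1) using card_of_image ordLeq_transitive by blast
qed

theorem theorem5p12:
  shows "b_Fin =o add_null \<and> d_Fin =o cof_null"
proof -
  \<comment> \<open>The pair \<open>\<phi>\<close>, \<open>limsup_set\<close> is one connection and
    the pair \<open>\<Phi>\<close>, \<open>\<Psi>\<close> the other; each yields one inequality for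
    each cardinal.\<close>
  obtain \<phi> where \<phi>: "\<And>A. A \<in> null_ideal \<Longrightarrow> \<phi> A \<in> Omega_bar \<and> A \<subseteq> limsup_set (\<phi> A)"
    using null_subset_limsup_set by metis
  obtain \<Phi> where \<Phi>: "\<And>c. c \<in> Omega_bar \<Longrightarrow> \<Phi> c \<in> null_ideal"
    "\<forall>A\<in>null_ideal. \<exists>d\<in>Omega_bar. \<forall>c\<in>Omega_bar. \<Phi> c \<subseteq> A \<longrightarrow> c \<subseteq>\<^sub>F\<^sub>i\<^sub>n d"
    using Omega_bar_null_connection by auto
  obtain \<Psi> where \<Psi>: "\<And>A. A \<in> null_ideal \<Longrightarrow> \<Psi> A \<in> Omega_bar"
    "\<And>A c. A \<in> null_ideal \<Longrightarrow> c \<in> Omega_bar \<Longrightarrow> \<Phi> c \<subseteq> A \<Longrightarrow> c \<subseteq>\<^sub>F\<^sub>i\<^sub>n \<Psi> A"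
    using \<Phi>(2) by metis
  have limsup_null: "limsup_set d \<in> null_ideal" if "d \<in> Omega_bar" for d
    using that by (simp add: Omega_bar_iff)
  have below: "A \<subseteq> limsup_set d" if "A \<in> null_ideal" "\<phi> A \<subseteq>\<^sub>F\<^sub>i\<^sub>n d" for A d
    using \<phi>[OF that(1)] subseteq_Fin_limsup_mono[OF that(2)] by blast
  have "b_Fin \<le>o add_null"
    unfolding b_Fin_def add_null_def
  proof (rule least_size_image_le[OF ex_add_null])
    fix F assume F: "F \<subseteq> null_ideal \<and> \<Union>F \<notin> null_ideal"
    have False if d: "d \<in> Omega_bar" "\<forall>c\<in>\<phi> ` F. c \<subseteq>\<^sub>F\<^sub>i\<^sub>n d" for d
    proof -
      have "\<Union>F \<subseteq> limsup_set d"
        using F d(2) below by blast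
      then show False
        using F limsup_null[OF d(1)] null_ideal_subset by blast
    qed
    then show "unbounded_Fin (\<phi> ` F)"
      unfolding unbounded_Fin_def using F \<phi> by blast
  qed
  moreover have "add_null \<le>o b_Fin"
    unfolding b_Fin_def add_null_def
  proof (rule least_size_image_le[OF ex_unbounded_Fin])
    fix B assume B: "unbounded_Fin B"
    then have sub: "B \<subseteq> Omega_bar"
      by (simp add: unbounded_Fin_def)
    have "\<Union>(\<Phi> ` B) \<notin> null_ideal"
    proof
      assume null: "\<Union>(\<Phi> ` B) \<in> null_ideal"
      have "\<forall>c\<in>B. c \<subseteq>\<^sub>F\<^sub>i\<^sub>n \<Psi> (\<Union>(\<Phi> ` B))"
        using sub \<Psi>(2)[OF null] by blast
      then show False
        using B \<Psi>(1)[OF null] by (auto simp: unbounded_Fin_def)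
    qed
    then show "\<Phi> ` B \<subseteq> null_ideal \<and> \<Union>(\<Phi> ` B) \<notin> null_ideal"
      using sub \<Phi>(1) by blast
  qed
  moreover have "d_Fin \<le>o cof_null"
    unfolding d_Fin_def cof_null_def
  proof (rule least_size_image_le[OF ex_cof_null])
    fix F assume F: "F \<subseteq> null_ideal \<and> (\<forall>A\<in>null_ideal. \<exists>B\<in>F. A \<subseteq> B)"
    \<comment> \<open>A member of \<open>F\<close> containing \<open>\<Phi> c\<close> is sent by
      \<open>\<Psi>\<close> to a bound of \<open>c\<close>.\<close>
    have "\<exists>d\<in>\<Psi> ` F. c \<subseteq>\<^sub>F\<^sub>i\<^sub>n d" if "c \<in> Omega_bar" for c
      using F \<Phi>(1)[OF that] \<Psi>(2)[OF _ that] by blast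
    then show "dominating_Fin (\<Psi> ` F)"
      using F \<Psi>(1) by (auto simp: dominating_Fin_def)
  qed
  moreover have "cof_null \<le>o d_Fin"
    unfolding d_Fin_def cof_null_def
  proof (rule least_size_image_le[OF ex_dominating_Fin])
    fix D assume D: "dominating_Fin D"
    have "\<exists>B\<in>limsup_set ` D. A \<subseteq> B" if "A \<in> null_ideal" for A
      using D \<phi>[OF that] below[OF that] unfolding dominating_Fin_def by blast
    then show "limsup_set ` D \<subseteq> null_ideal \<and> (\<forall>A\<in>null_ideal. \<exists>B\<in>limsup_set ` D. A \<subseteq> B)"
      using D limsup_null by (auto simp: dominating_Fin_def)
  qed
  ultimately show ?thesis
    by (simp add: ordIso_iff_ordLeq)
qed

end
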